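(* Let $n\ge 1$, let $a_1,\dots,a_n$ be pairwise relatively prime positive integers, and let $t$ be an integer with $0<t<a_1+\dots+a_n$. Then $$\sum_{j=1}^n\sigma_t(a_1,\dots,\hat a_j,\dots,a_n;a_j)=-R'_t(a_1,\dots,a_n),$$ where $\hat a_j$ means that the entry $a_j$ is omitted, and $$R'_t(a_1,\dots,a_n)=\operatorname{Res}\left(\frac{z^{t-1}}{(z^{a_1}-1)\cdots(z^{a_n}-1)},\,z=1\right).$$
   Context: Fourier-Dedekind sum: for integers $c_1,\dots,c_m$ each relatively prime to a positive integer $c$, and $t\in\mathbb Z$, $$\sigma_t(c_1,\dots,c_m;c)=\frac1c\sum_{\lambda^c=1,\ \lambda\ne1}\frac{\lambda^t}{(\lambda^{c_1}-1)\cdots(\lambda^{c_m}-1)},$$ the sum being over all complex $c$-th roots of unity $\lambda\neq 1$ (so it is $0$ if $c=1$); an empty product in the denominator is $1$. $\operatorname{Res}(G(z),z=1)$ denotes the residue of the meromorphic function $G$ at $z=1$. *)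

theory Defs
  imports "HOL-Complex_Analysis.Complex_Analysis"
begin

text \<open>
  The tuple \<open>c\<^sub>1, \<dots>, c\<^sub>m\<close> is a family \<open>(c i)\<close> indexed by a finite set \<open>I\<close>, so omitting
  an entry means removing an index. The definition is meaningful for \<open>k > 0\<close> and every
  \<open>c i\<close> coprime to \<open>k\<close>; then no factor \<open>\<omega>\<^bsup>c i\<^esup> - 1\<close> vanishes.
\<close>

definition fourier_dedekind :: "int \<Rightarrow> 'i set \<Rightarrow> ('i \<Rightarrow> int) \<Rightarrow> nat \<Rightarrow> complex" where
  "fourier_dedekind t I c k =
     1 / of_nat k *
     (\<Sum>\<omega> | \<omega> ^ k = 1 \<and> \<omega> \<noteq> 1. \<omega> powi t / (\<Prod>i\<in>I. \<omega> powi c i - 1))"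

definition residue_part :: "int \<Rightarrow> 'i set \<Rightarrow> ('i \<Rightarrow> nat) \<Rightarrow> complex" where
  "residue_part t I a = residue (\<lambda>z. z powi (t - 1) / (\<Prod>i\<in>I. z ^ a i - 1)) 1"

end

theory Submission
  imports Defs
begin

text \<open>
  The sum of all residues of \<open>G(z) = z\<^bsup>t-1\<^esup> / \<Prod>\<^sub>i (z\<^bsup>a\<^sub>i\<^esup> - 1)\<close> vanishes, because \<open>z G(z) \<rightarrow> 0\<close> at
  infinity when \<open>t < \<Sum>\<^sub>i a\<^sub>i\<close>. By pairwise coprimality every pole other than \<open>1\<close> is a root
  of exactly one factor \<open>z\<^bsup>a\<^sub>j\<^esup> - 1\<close>, hence simple, and the residues at the nontrivial
  \<open>a\<^sub>j\<close>-th roots of unity are the terms of the \<open>j\<close>-th Fourier-Dedekind sum.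
\<close>

text \<open>Bezout writes \<open>w\<close> as a quotient of a power of \<open>w ^ m\<close> by a
  power of \<open>w ^ n\<close>.\<close>

lemma eq_1_if_coprime_powers_eq_1:
  fixes w :: complex
  assumes "coprime m n" "w ^ m = 1" "w ^ n = 1"
  shows "w = 1"
proof (cases "m = 0")
  \<comment> \<open>Coprimality with 0 forces \<open>n = 1\<close>.\<close>
  case True
  with assms show ?thesis by simp
next
  case False
  then obtain x y where xy: "m * x = n * y + 1"
    using bezout_nat[of m n] assms(1) by auto
  have "1 = (w ^ m) ^ x" using assms by simp
  also have "\<dots> = w ^ (n * y + 1)" unfolding power_mult[symmetric] xy ..
  also have "\<dots> = (w ^ n) ^ y * w" by (simp add: power_add power_mult)
  finally show ?thesis using assms by simp
qed

text \<open>A large circle around \<open>S\<close> picks up every residue once, while the decay of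
  \<open>z * f z\<close> beats the growth of the circumference. Points of \<open>S\<close> need not
  be actual poles.\<close>

lemma sum_residues_eq_0:
  fixes f :: "complex \<Rightarrow> complex"
  assumes "finite S" and holo: "f holomorphic_on - S"
    and lim: "((\<lambda>z. z * f z) \<longlongrightarrow> 0) at_infinity"
  shows "(\<Sum>p\<in>S. residue f p) = 0"
proof -
  obtain R where R: "R > 0" "\<And>p. p \<in> S \<Longrightarrow> norm p < R"
  proof -
    obtain R0 where "R0 > 0" "\<forall>p\<in>S. norm p \<le> R0"
      using finite_imp_bounded[OF \<open>finite S\<close>] bounded_pos by blast
    then show ?thesis using that[of "R0 + 1"] by force
  qed
  have "norm (\<Sum>p\<in>S. residue f p) \<le> e" if "e > 0" for e
  proof -
    have "\<forall>\<^sub>F z in at_infinity. norm (z * f z) < e"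
      using tendstoD[OF lim \<open>e > 0\<close>] by simp
    then obtain B where B: "\<And>z. norm z \<ge> B \<Longrightarrow> norm (z * f z) < e"
      by (auto simp: eventually_at_infinity)
    \<comment> \<open>\<open>B\<close> makes the decay estimate valid on the circle,
      \<open>R\<close> puts all of \<open>S\<close> inside it.\<close>
    define r where "r = max B R"
    have r: "r > 0" "\<And>p. p \<in> S \<Longrightarrow> norm p < r"
      using R by (auto simp: r_def less_max_iff_disj)
    let ?g = "circlepath 0 r"
    have sub: "path_image ?g \<subseteq> - S" using r by force
    have opn: "open (- S)" using \<open>finite S\<close> by (simp add: finite_imp_closed open_Compl)
    have "contour_integral ?g f = 2 * pi * \<i> * (\<Sum>p\<in>S. winding_number ?g p * residue f p)"
      using holo sub by (intro Residue_theorem[of UNIV]) (auto simp: \<open>finite S\<close> Compl_eq_Diff_UNIV)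
    also have "(\<Sum>p\<in>S. winding_number ?g p * residue f p) = (\<Sum>p\<in>S. residue f p)"
      using r(2) by (intro sum.cong) (auto simp: winding_number_circlepath)
    finally have eq: "contour_integral ?g f = 2 * pi * \<i> * (\<Sum>p\<in>S. residue f p)" .
    \<comment> \<open>The radius cancels and leaves \<open>2 * pi * e\<close>, whose factor
      \<open>2 * pi\<close> is the one in the residue theorem.\<close>
    have "norm (contour_integral ?g f) \<le> e / r * (2 * pi * r)"
    proof (rule has_contour_integral_bound_circlepath)
      show "(f has_contour_integral contour_integral ?g f) ?g"
        by (intro has_contour_integral_integral contour_integrable_holomorphic_simple[OF holo opn])
           (use sub in auto)
      show "norm (f z) \<le> e / r" if "norm (z - 0) = r" for z
      proof -
        have "norm z * norm (f z) < e"
          using B[of z] that by (simp add: r_def norm_mult)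
        then show ?thesis using that r(1) by (simp add: field_simps)
      qed
    qed (use r \<open>e > 0\<close> in auto)
    then show ?thesis using r(1) by (simp add: eq norm_mult)
  qed
  then show ?thesis
    using field_le_epsilon[of "norm (\<Sum>p\<in>S. residue f p)" 0] by simp
qed

text \<open>Compare degrees: for \<open>a i > 0\<close> the constant -1 leaves the leading term of
  each factor intact, so the denominator has degree \<open>\<Sum>i\<in>I. a i\<close>.\<close>

lemma prod_power_minus_1_tendsto_0:
  fixes a :: "'i \<Rightarrow> nat"
  assumes "finite I" "\<And>i. i \<in> I \<Longrightarrow> a i > 0" "m < (\<Sum>i\<in>I. a i)"
  shows "((\<lambda>z::complex. z ^ m / (\<Prod>i\<in>I. z ^ a i - 1)) \<longlongrightarrow> 0) at_infinity"
proof -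
  define p :: "'i \<Rightarrow> complex poly" where "p = (\<lambda>i. monom 1 (a i) - 1)"
  have deg: "degree (p i) = a i" if "i \<in> I" for i
  proof -
    have "degree (monom 1 (a i) + (- 1) :: complex poly) = degree (monom 1 (a i) :: complex poly)"
      using assms(2)[OF that] by (intro degree_add_eq_left) (simp add: degree_monom_eq)
    then show ?thesis by (simp add: p_def degree_monom_eq)
  qed
  have "p i \<noteq> 0" if "i \<in> I" for i
    using deg[OF that] assms(2)[OF that] by auto
  then have "degree (prod p I) = (\<Sum>i\<in>I. a i)"
    using deg by (simp add: degree_prod_sum_eq)
  then have "((\<lambda>z. poly (monom 1 m) z / poly (prod p I) z) \<longlongrightarrow> 0) at_infinity"
    using assms(3) by (intro poly_divide_tendsto_0_at_infinity) (simp add: degree_monom_eq)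
  then show ?thesis by (simp add: poly_monom poly_prod p_def)
qed

text \<open>Only the factor with index \<open>j\<close> vanishes at \<open>w\<close>, and its
  derivative there is nonzero. So the pole is simple, and the residue is the remaining quotient at
  \<open>w\<close> divided by that derivative.\<close>

lemma residue_at_root_of_unity:
  fixes a :: "'i \<Rightarrow> nat" and w :: complex
  assumes "finite I" "j \<in> I" "a j > 0" "w ^ a j = 1"
    and nz: "\<And>i. i \<in> I - {j} \<Longrightarrow> w ^ a i \<noteq> 1"
  shows "residue (\<lambda>z. z ^ m / (\<Prod>i\<in>I. z ^ a i - 1)) w
         = 1 / of_nat (a j) * (w ^ Suc m / (\<Prod>i\<in>I - {j}. w ^ a i - 1))"
proof -
  have w0: "w \<noteq> 0" using assms(3,4) by (auto simp: power_0_left)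
  define S where "S = {z::complex. (\<Prod>i\<in>I - {j}. z ^ a i - 1) \<noteq> 0}"
  have "open S" unfolding S_def by (intro open_Collect_neq continuous_intros)
  moreover have "w \<in> S" using nz \<open>finite I\<close> by (auto simp: S_def)
  ultimately obtain e where e: "e > 0" "ball w e \<subseteq> S" by (meson open_contains_ball)
  have "residue (\<lambda>z. z ^ m / (\<Prod>i\<in>I - {j}. z ^ a i - 1) / (z ^ a j - 1)) w
        = w ^ m / (\<Prod>i\<in>I - {j}. w ^ a i - 1) / (of_nat (a j) * w ^ (a j - 1))"
  proof (rule residue_simple_pole_deriv[of _ "ball w e"])
    show "(\<lambda>z. z ^ m / (\<Prod>i\<in>I - {j}. z ^ a i - 1)) holomorphic_on ball w e"
      using e by (intro holomorphic_intros) (auto simp: S_def)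
    show "((\<lambda>z. z ^ a j - 1) has_field_derivative of_nat (a j) * w ^ (a j - 1)) (at w)"
      by (auto intro!: derivative_eq_intros)
  qed (use e w0 \<open>w \<in> S\<close> assms in \<open>auto intro!: holomorphic_intros simp: S_def\<close>)
  \<comment> \<open>The derivative is thus \<open>of_nat (a j) / w\<close>; this \<open>w\<close>
    raises the exponent from \<open>m\<close> to \<open>Suc m\<close>, that is, from
    \<open>t - 1\<close> to \<open>t\<close>.\<close>
  moreover have "w ^ (a j - 1) = 1 / w"
    using assms(3,4) w0 by (metis power_minus_mult nonzero_eq_divide_eq)
  then have "w ^ m / x / (of_nat (a j) * w ^ (a j - 1)) = 1 / of_nat (a j) * (w ^ Suc m / x)" for x
    by (simp add: mult_ac)
  moreover have "(\<Prod>i\<in>I. z ^ a i - 1) = (\<Prod>i\<in>I - {j}. z ^ a i - 1) * (z ^ a j - 1)" for z :: complex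
    using assms(1,2) by (simp add: prod.remove mult.commute)
  ultimately show ?thesis by simp
qed

theorem theorem8:
  fixes n :: nat and a :: "nat \<Rightarrow> nat" and t :: int
  assumes "n \<ge> 1"
    and "\<And>i. i \<in> {1..n} \<Longrightarrow> a i > 0"
    and "\<And>i j. i \<in> {1..n} \<Longrightarrow> j \<in> {1..n} \<Longrightarrow> i \<noteq> j \<Longrightarrow> coprime (a i) (a j)"
    and "0 < t" and "t < (\<Sum>i=1..n. int (a i))"
  shows "(\<Sum>j=1..n. fourier_dedekind t ({1..n} - {j}) (\<lambda>i. int (a i)) (a j))
         = - residue_part t {1..n} a"
proof -
  define I where "I = {1..n}"
  \<comment> \<open>Since \<open>0 < t\<close>, the exponent \<open>t - 1\<close> is a natural
    number, so the numerator creates no pole at 0.\<close>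
  define m where "m = nat (t - 1)"
  have tm: "t - 1 = int m" "t = int (Suc m)" using assms(4) by (auto simp: m_def)
  define G where "G = (\<lambda>z::complex. z ^ m / (\<Prod>i\<in>I. z ^ a i - 1))"
  define A where "A = (\<lambda>j. {w::complex. w ^ a j = 1 \<and> w \<noteq> 1})"
  have [simp]: "finite I" by (simp add: I_def)
  have pos: "a i > 0" if "i \<in> I" for i using assms(2) that by (simp add: I_def)
  have cop: "coprime (a i) (a j)" if "i \<in> I" "j \<in> I" "i \<noteq> j" for i j
    using assms(3) that by (simp add: I_def)
  have finA: "finite (A j)" if "j \<in> I" for j
    using finite_roots_unity[of "a j", where ?'a = complex] pos[OF that] by (auto simp: A_def)
  have disj: "A i \<inter> A j = {}" if "i \<in> I" "j \<in> I" "i \<noteq> j" for i j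
    using eq_1_if_coprime_powers_eq_1 cop[OF that] by (auto simp: A_def)
  have "(\<Sum>p\<in>insert 1 (\<Union>j\<in>I. A j). residue G p) = 0"
  proof (rule sum_residues_eq_0)
    show "G holomorphic_on - insert 1 (\<Union>j\<in>I. A j)"
      unfolding G_def by (intro holomorphic_intros) (auto simp: A_def)
    \<comment> \<open>The extra factor \<open>z\<close> raises the numerator degree to
      \<open>t\<close>, which is where the upper bound on \<open>t\<close> enters.\<close>
    have "int (Suc m) < int (\<Sum>i\<in>I. a i)" using assms(5) tm by (simp add: I_def)
    then have "Suc m < (\<Sum>i\<in>I. a i)" by linarith
    then have "((\<lambda>z. z ^ Suc m / (\<Prod>i\<in>I. z ^ a i - 1)) \<longlongrightarrow> (0::complex)) at_infinity"
      using pos by (intro prod_power_minus_1_tendsto_0) auto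
    then show "((\<lambda>z. z * G z) \<longlongrightarrow> 0) at_infinity" by (simp add: G_def)
  qed (use finA in auto)
  \<comment> \<open>The point 1 is a root of every factor, so its residue is split off and left
    unevaluated.\<close>
  moreover have "1 \<notin> (\<Union>j\<in>I. A j)" by (auto simp: A_def)
  ultimately have "residue G 1 + (\<Sum>p\<in>(\<Union>j\<in>I. A j). residue G p) = 0"
    using finA by simp
  also have "(\<Sum>p\<in>(\<Union>j\<in>I. A j). residue G p) = (\<Sum>j\<in>I. \<Sum>p\<in>A j. residue G p)"
    using finA disj by (intro sum.UNION_disjoint) auto
  also have "\<dots> = (\<Sum>j\<in>I. fourier_dedekind t (I - {j}) (\<lambda>i. int (a i)) (a j))"
  proof (rule sum.cong)
    fix j assume j: "j \<in> I"
    have "residue G w = 1 / of_nat (a j) * (w ^ Suc m / (\<Prod>i\<in>I - {j}. w ^ a i - 1))"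
      if w: "w \<in> A j" for w
      unfolding G_def
    proof (rule residue_at_root_of_unity)
      \<comment> \<open>Otherwise \<open>w\<close> would lie in both \<open>A i\<close> and
        \<open>A j\<close>.\<close>
      show "w ^ a i \<noteq> 1" if "i \<in> I - {j}" for i
        using disj[of i j] that j w by (auto simp: A_def)
    qed (use j w pos in \<open>auto simp: A_def\<close>)
    then show "(\<Sum>p\<in>A j. residue G p) = fourier_dedekind t (I - {j}) (\<lambda>i. int (a i)) (a j)"
      unfolding fourier_dedekind_def tm(2) power_int_of_nat sum_distrib_left
      by (intro sum.cong) (auto simp: A_def)
  qed simp
  also have "residue G 1 = residue_part t I a"
    by (simp add: residue_part_def G_def tm(1))
  finally show ?thesis by (simp add: I_def add_eq_0_iff2 add_eq_0_iff)
qed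

end
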